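(* Assume $\delta_i=o(T/\log T)$ for all arms $i$, and let $\alpha\le 1/8$ and $\gamma=2(1+1/\alpha)(1+2/\alpha)$. Then \[\max\Big\{\sum_i R(\mathcal{P}_i)\;:\;\mathcal{P}_i \text{ a single-arm policy of arm } i \text{ with horizon } T,\ \sum_i N(\mathcal{P}_i)\le T\Big\}\] is at most $1/\alpha$ times \[\max\Big\{\sum_i R(\mathcal{P}'_i)\;:\;\mathcal{P}'_i \text{ a truncated } \big(\alpha,\tfrac{\alpha}{\alpha+2}\big)\text{-well-structured policy of arm } i,\ \sum_i N(\mathcal{P}'_i)\le \gamma T\Big\}.\]
   Context: Setting: $n$ independent Bayesian bandit arms; arm $i$ has an unknown reward distribution $D_i$ drawn from a known prior, each play yields a reward drawn i.i.d. from $D_i$, the outcome of a play of arm $i$ is revealed only $\delta_i$ time steps later and beliefs are updated by Bayes' rule; arm $i$ has a budget $B_i$ on its total reward. Let $Q_i=T/\delta_i$. A single-arm policy of arm $i$ with horizon $H$ is a (randomized) rule acting only on arm $i$ over at most $H$ time steps which makes a play, waits, or quits based on its current information; $R(\cdot)$ and $N(\cdot)$ denote its expected reward and expected number of plays. A policy is block structured if it executes in blocks of $2\delta_i+1$ time steps, making at most $\delta_i+1$ consecutive plays at the start of each block and waiting for the rest of the block. A block structured policy is $c$-delay-free if, the first time it encounters a block with at least $c\delta_i$ plays, from then on it plays at every step without waiting until it stops. A $c$-delay-free block structured policy is $(\alpha,c)$-well-structured if on every decision path, after at most $(\alpha+o(1))Q_i$ blocks, it switches to playing continuously. A truncated well-structured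 policy is a well-structured policy that terminates upon reaching $T/2$ time steps.
   Formalization: Rewards are assumed nonnegative (almost surely under the prior), which the statement leaves implicit; with negative rewards it fails, e.g. one arm with delay 1 and budget 100 whose reward is always 1 with probability 1/80 and always −1 otherwise. *)

theory Defs
  imports "HOL-Probability.Probability" "HOL-Library.Landau_Symbols"
begin

text \<open>The prior is a probability measure on the space of probability measures on the reals;
  \<open>arm_delay\<close> is \<open>\<delta>\<^sub>i\<close> and \<open>arm_budget\<close> is \<open>B\<^sub>i\<close>.\<close>

record arm =
  arm_prior :: "real measure measure"
  arm_delay :: nat
  arm_budget :: real

definition valid_arm :: "arm \<Rightarrow> bool" where
  "valid_arm A \<longleftrightarrow>
     arm_prior A \<in> space (prob_algebra (prob_algebra borel)) \<and>
     (AE D in arm_prior A. AE r in D. 0 \<le> r) \<and>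
     0 < arm_delay A \<and> 0 \<le> arm_budget A"

datatype action = Play | Wait | Quit

text \<open>A randomized policy draws a seed \<open>u\<close>, uniform on the unit interval and independent of the
  arm, and then chooses an action from the time step and the list of outcomes revealed so far.
  Its own past actions, and the times at which outcomes were revealed, are functions of the seed
  and of the prefixes of that list; so is the posterior, which is therefore not a separate argument.\<close>

type_synonym policy = "real \<Rightarrow> nat \<Rightarrow> real list \<Rightarrow> action"

text \<open>The actions in time steps \<open>0, \<dots>, t - 1\<close>, for delay \<open>d\<close> and a fixed seed, when the
  \<open>k\<close>-th play has outcome \<open>x k\<close>. The outcome of a play in step \<open>s\<close> is revealed at the end of
  step \<open>s + d\<close>, so in step \<open>t\<close> it is known iff \<open>s + d < t\<close>; for \<open>d = 0\<close> this is the
  bandit without delay. With this convention the plays of one block of at most \<open>d + 1\<close> plays are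
  made before any of them is revealed, and all of them are known \<open>2 * d + 1\<close> steps after
  the start of the block.\<close>

primrec history :: "nat \<Rightarrow> (nat \<Rightarrow> real list \<Rightarrow> action) \<Rightarrow> (nat \<Rightarrow> real) \<Rightarrow> nat \<Rightarrow> action list" where
  "history d p x 0 = []"
| "history d p x (Suc t) = history d p x t @
     [if Quit \<in> set (history d p x t) then Quit
      else p t (map x [0..<count_list (take (t - d) (history d p x t)) Play])]"

definition action_at :: "nat \<Rightarrow> (nat \<Rightarrow> real list \<Rightarrow> action) \<Rightarrow> (nat \<Rightarrow> real) \<Rightarrow> nat \<Rightarrow> action" where
  "action_at d p x t = last (history d p x (Suc t))"

definition measurable_policy :: "policy \<Rightarrow> bool" where
  "measurable_policy P \<longleftrightarrow>
     (\<forall>t k. (\<lambda>(u, x). P u t (map x [0..<k]))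
        \<in> measurable (borel \<Otimes>\<^sub>M PiM (UNIV :: nat set) (\<lambda>_. borel)) (count_space UNIV))"

definition single_arm_policies :: "arm \<Rightarrow> nat \<Rightarrow> policy set" where
  "single_arm_policies A H =
     {P. measurable_policy P \<and> (\<forall>u x. action_at (arm_delay A) (P u) x H = Quit)}"

definition num_plays :: "arm \<Rightarrow> policy \<Rightarrow> real \<Rightarrow> (nat \<Rightarrow> real) \<Rightarrow> nat" where
  "num_plays A P u x = card {t. action_at (arm_delay A) (P u) x t = Play}"

text \<open>The expectation of \<open>f\<close> over the reward distribution \<open>D\<close>, the seed, and the outcomes,
  which are i.i.d. given \<open>D\<close>.\<close>

definition arm_expectation :: "arm \<Rightarrow> (real \<Rightarrow> (nat \<Rightarrow> real) \<Rightarrow> ennreal) \<Rightarrow> ennreal" where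
  "arm_expectation A f =
     (\<integral>\<^sup>+D. (\<integral>\<^sup>+u. (\<integral>\<^sup>+x. f u x \<partial>PiM UNIV (\<lambda>_. D)) \<partial>uniform_measure lborel {0..1})
        \<partial>arm_prior A)"

definition expected_reward :: "arm \<Rightarrow> policy \<Rightarrow> ennreal" where
  "expected_reward A P =
     arm_expectation A (\<lambda>u x. ennreal (min (arm_budget A) (\<Sum>k<num_plays A P u x. x k)))"

definition expected_plays :: "arm \<Rightarrow> policy \<Rightarrow> ennreal" where
  "expected_plays A P = arm_expectation A (\<lambda>u x. of_nat (num_plays A P u x))"

text \<open>In the following, \<open>a\<close> is the sequence of actions on one decision path.\<close>

definition block :: "nat \<Rightarrow> nat \<Rightarrow> nat set" where
  "block d b = {b * (2 * d + 1)..<Suc b * (2 * d + 1)}"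

definition block_plays :: "nat \<Rightarrow> (nat \<Rightarrow> action) \<Rightarrow> nat \<Rightarrow> nat" where
  "block_plays d a b = card {t \<in> block d b. a t = Play}"

definition block_shaped :: "nat \<Rightarrow> (nat \<Rightarrow> action) \<Rightarrow> nat \<Rightarrow> bool" where
  "block_shaped d a b \<longleftrightarrow>
     (\<exists>m\<le>d + 1. \<forall>t\<in>block d b. a t = Play \<longleftrightarrow> t < b * (2 * d + 1) + m)"

text \<open>Since quitting is permanent, playing at every step until the policy stops means never
  waiting. The block structure is only required before the first block with at least
  \<open>c * d\<close> plays: from the start of that block on, there is no waiting.\<close>

definition plays_continuously_from :: "nat \<Rightarrow> (nat \<Rightarrow> action) \<Rightarrow> nat \<Rightarrow> bool" where
  "plays_continuously_from d a b \<longleftrightarrow> (\<forall>t\<ge>b * (2 * d + 1). a t \<noteq> Wait)"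

definition delay_free_block_structured :: "real \<Rightarrow> nat \<Rightarrow> (nat \<Rightarrow> action) \<Rightarrow> bool" where
  "delay_free_block_structured c d a \<longleftrightarrow>
     (\<forall>b. (\<forall>b'<b. real (block_plays d a b') < c * real d) \<longrightarrow>
        (if real (block_plays d a b) < c * real d then block_shaped d a b
         else plays_continuously_from d a b))"

text \<open>The parameter \<open>\<beta>\<close> stands for \<open>\<alpha> + o(1)\<close>, and \<open>T / d\<close> is \<open>Q\<^sub>i\<close>.\<close>

definition well_structured :: "nat \<Rightarrow> real \<Rightarrow> real \<Rightarrow> nat \<Rightarrow> (nat \<Rightarrow> action) \<Rightarrow> bool" where
  "well_structured T \<beta> c d a \<longleftrightarrow>
     delay_free_block_structured c d a \<and>
     (\<exists>b. real b \<le> \<beta> * (real T / real d) \<and> plays_continuously_from d a b)"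

definition truncated_well_structured_policies :: "arm \<Rightarrow> nat \<Rightarrow> real \<Rightarrow> real \<Rightarrow> policy set" where
  "truncated_well_structured_policies A T \<beta> c =
     {P \<in> single_arm_policies A (T div 2).
        \<forall>u x. well_structured T \<beta> c (arm_delay A) (action_at (arm_delay A) (P u) x)}"

definition optimal_reward :: "nat \<Rightarrow> (nat \<Rightarrow> arm) \<Rightarrow> (arm \<Rightarrow> policy set) \<Rightarrow> real \<Rightarrow> ennreal" where
  "optimal_reward n A C K =
     (SUP P \<in> {P :: nat \<Rightarrow> policy. (\<forall>i<n. P i \<in> C (A i)) \<and>
                 (\<Sum>i<n. expected_plays (A i) (P i)) \<le> ennreal K}.
        \<Sum>i<n. expected_reward (A i) (P i))"

end

theory Submission
  imports Defs
begin

text \<open>The number \<open>N\<close> of plays of a single-arm policy is a stopping time of the outcome sequence, and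
  nothing else about the policy is needed. The new policy follows a fixed schedule: block \<open>b\<close> makes
  \<open>2 ^ b\<close> plays while \<open>2 ^ b < c * d\<close>, and from then on every step is a play; it quits as soon as the
  revealed outcomes show that the original policy would have stopped, or at time \<open>T div 2\<close>.
  During the doubling phase it overshoots \<open>N\<close> by a factor of at most \<open>2\<close>; in the continuous
  phase it overshoots by at most \<open>d\<close>, while \<open>N \<ge> c * d\<close>. Hence it makes at most \<open>(1 + 1 / c) * N\<close>
  plays. The doubling phase has \<open>O(log T)\<close> blocks, which is below \<open>\<alpha> * T / d\<close> for large \<open>T\<close>, so
  \<open>\<epsilon> = 0\<close> works, and at least \<open>T / 8\<close> plays are scheduled before \<open>T div 2\<close>.
  Finally, since rewards are nonnegative and exchangeable and the budget caps them concavely, the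
  expected marginal reward of successive plays of a stopped sequence is decreasing, so the first
  \<open>H\<close> of at most \<open>T\<close> plays earn at least the fraction \<open>H / T\<close> of the reward.\<close>


section \<open>Plays on a decision path\<close>

definition plays_before :: "(nat \<Rightarrow> action) \<Rightarrow> nat \<Rightarrow> nat" where
  "plays_before a n = card {t. t < n \<and> a t = Play}"

lemma plays_before_0 [simp]: "plays_before a 0 = 0"
  by (simp add: plays_before_def)

lemma plays_before_Suc:
  "plays_before a (Suc n) = plays_before a n + (if a n = Play then 1 else 0)"
proof -
  have "{t. t < Suc n \<and> a t = Play} =
      (if a n = Play then insert n {t. t < n \<and> a t = Play} else {t. t < n \<and> a t = Play})"
    by (auto simp: less_Suc_eq)
  then show ?thesis
    by (simp add: plays_before_def)
qed

lemma plays_before_mono: "m \<le> n \<Longrightarrow> plays_before a m \<le> plays_before a n"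
  unfolding plays_before_def by (rule card_mono) auto

lemma plays_before_add_le: "plays_before a (n + k) \<le> plays_before a n + k"
  by (induction k) (auto simp: plays_before_Suc)

lemma plays_before_cong:
  "(\<And>t. t < n \<Longrightarrow> a t = a' t) \<Longrightarrow> plays_before a n = plays_before a' n"
  unfolding plays_before_def by (metis (mono_tags, lifting))

lemma count_list_map_Play: "count_list (map a [0..<n]) Play = plays_before a n"
  by (induction n) (auto simp: plays_before_Suc)

lemma history_eq_map: "history d p x t = map (action_at d p x) [0..<t]"
proof (induction t)
  case (Suc t)
  have "history d p x (Suc t) = history d p x t @ [last (history d p x (Suc t))]"
    by simp
  then show ?case
    using Suc by (simp add: action_at_def del: history.simps)
qed simp

lemma action_at_rec:
  "action_at d p x t =
     (if \<exists>s<t. action_at d p x s = Quit then Quit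
      else p t (map x [0..<plays_before (action_at d p x) (t - d)]))"
proof -
  have "take (t - d) (history d p x t) = map (action_at d p x) [0..<t - d]"
    by (simp add: history_eq_map take_map)
  moreover have "Quit \<in> set (history d p x t) \<longleftrightarrow> (\<exists>s<t. action_at d p x s = Quit)"
    by (force simp: history_eq_map)
  ultimately show ?thesis
    by (subst action_at_def) (auto simp: count_list_map_Play)
qed

lemma action_at_Quit_mono:
  assumes "action_at d p x s = Quit" "s \<le> t"
  shows "action_at d p x t = Quit"
  using assms by (cases "s = t") (auto simp: action_at_rec[of d p x t])

text \<open>Until more than \<open>k\<close> plays have been made, the revealed outcomes form a
  prefix of length at most \<open>k\<close>, on which \<open>x\<close> and \<open>y\<close> agree.
  Hence the disjunction in the induction: all actions so far coincide, or both counts exceed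
  \<open>k\<close>.\<close>

lemma plays_before_nonanticipating:
  assumes "\<And>i. i < k \<Longrightarrow> x i = y i"
  shows "k < plays_before (action_at d p x) t \<longleftrightarrow> k < plays_before (action_at d p y) t"
proof -
  let ?a = "action_at d p x" and ?b = "action_at d p y"
  have "(\<forall>s<t. ?a s = ?b s) \<or> (k < plays_before ?a t \<and> k < plays_before ?b t)"
  proof (induction t)
    case (Suc t)
    then show ?case
    proof
      assume eq: "\<forall>s<t. ?a s = ?b s"
      then have pb: "plays_before ?a (t - d) = plays_before ?b (t - d)"
        by (intro plays_before_cong) auto
      show ?thesis
      proof (cases "k < plays_before ?a (t - d)")
        case True
        moreover have "plays_before c (t - d) \<le> plays_before c (Suc t)" for c
          by (rule plays_before_mono) simp
        ultimately show ?thesis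
          using pb by (metis order_less_le_trans)
      next
        case False
        then have "map x [0..<plays_before ?a (t - d)] = map y [0..<plays_before ?b (t - d)]"
          using assms pb by auto
        moreover have "(\<exists>s<t. ?a s = Quit) \<longleftrightarrow> (\<exists>s<t. ?b s = Quit)"
          using eq by auto
        ultimately have "?a t = ?b t"
          by (simp only: action_at_rec[of d p x t] action_at_rec[of d p y t])
        then show ?thesis
          using eq by (auto simp: less_Suc_eq)
      qed
    qed (auto simp: plays_before_Suc)
  qed simp
  then show ?thesis
    using plays_before_cong[of t ?a ?b] by auto
qed

lemma num_plays_eq_plays_before:
  assumes "P \<in> single_arm_policies A H"
  shows "num_plays A P u x = plays_before (action_at (arm_delay A) (P u) x) H"
proof -
  have "action_at (arm_delay A) (P u) x H = Quit"
    using assms by (simp add: single_arm_policies_def)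
  then have "action_at (arm_delay A) (P u) x t \<noteq> Play" if "H \<le> t" for t
    using action_at_Quit_mono that by fastforce
  then show ?thesis
    unfolding num_plays_def plays_before_def by (metis not_le)
qed

lemma num_plays_nonanticipating:
  assumes "P \<in> single_arm_policies A H" "\<And>i. i < k \<Longrightarrow> x i = y i"
  shows "k < num_plays A P u x \<longleftrightarrow> k < num_plays A P u y"
  using plays_before_nonanticipating[of k x y] assms by (simp add: num_plays_eq_plays_before)

lemma num_plays_le_horizon:
  assumes "P \<in> single_arm_policies A H"
  shows "num_plays A P u x \<le> H"
  using plays_before_add_le[of _ 0 H] by (simp add: num_plays_eq_plays_before[OF assms])

section \<open>Measurability of the number of plays\<close>

instance action :: countable
  by countable_datatype

lemma measurable_history:
  assumes "measurable_policy P"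
  shows "(\<lambda>w. history d (P (fst w)) (snd w) t)
     \<in> measurable (borel \<Otimes>\<^sub>M PiM (UNIV :: nat set) (\<lambda>_. borel)) (count_space UNIV)"
    (is "_ \<in> measurable ?M _")
proof (induction t)
  case (Suc t)
  \<comment> \<open>Once the history \<open>h\<close> is fixed, the number of revealed outcomes is a
    constant, which is the form that \<open>measurable_policy\<close> covers; the countably many
    histories are then glued together.\<close>
  define g where "g h w = h @ [if Quit \<in> set h then Quit
    else P (fst w) t (map (snd w) [0..<count_list (take (t - d) h) Play])]" for h w
  have "(\<lambda>w. P (fst w) t (map (snd w) [0..<k])) \<in> measurable ?M (count_space UNIV)" for k
    using assms by (simp add: measurable_policy_def case_prod_unfold)
  then have g: "g h \<in> measurable ?M (count_space UNIV)" for h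
    unfolding g_def
    by (rule measurable_compose) simp
  show ?case
    using measurable_compose_countable[OF g Suc] by (simp add: g_def)
qed simp

lemma measurable_num_plays:
  assumes "P \<in> single_arm_policies A H"
  shows "(\<lambda>w. num_plays A P (fst w) (snd w))
     \<in> measurable (borel \<Otimes>\<^sub>M PiM (UNIV :: nat set) (\<lambda>_. borel)) (count_space UNIV)"
proof -
  have "measurable_policy P"
    using assms by (simp add: single_arm_policies_def)
  then have "(\<lambda>w. count_list (history (arm_delay A) (P (fst w)) (snd w) H) Play)
     \<in> measurable (borel \<Otimes>\<^sub>M PiM (UNIV :: nat set) (\<lambda>_. borel)) (count_space UNIV)"
    by (rule measurable_compose[OF measurable_history]) simp
  then show ?thesis
    by (simp add: num_plays_eq_plays_before[OF assms] history_eq_map count_list_map_Play)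
qed

section \<open>Expected rewards of stopped sequences\<close>

text \<open>Without measurability of \<open>f\<close>: it is applied to functions of \<open>D\<close> defined by integration over
  the infinite power of \<open>D\<close>.\<close>

lemma nn_integral_cmult_le:
  fixes f :: "'a \<Rightarrow> ennreal"
  assumes "0 < r"
  shows "(\<integral>\<^sup>+x. ennreal r * f x \<partial>M) \<le> ennreal r * (\<integral>\<^sup>+x. f x \<partial>M)"
  unfolding nn_integral_def[of M "\<lambda>x. ennreal r * f x"]
proof (rule SUP_least, safe)
  fix s assume s: "simple_function M s" "s \<le> (\<lambda>x. ennreal r * f x)"
  have inv: "ennreal r * ennreal (1 / r) = 1"
    using assms by (simp flip: ennreal_mult)
  have "integral\<^sup>S M s = (\<integral>\<^sup>+x. s x \<partial>M)"
    using s by (simp add: nn_integral_eq_simple_integral)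
  \<comment> \<open>The constant is pulled out of \<open>s\<close> rather than \<open>f\<close>:
    simple functions are measurable, and the rescaled \<open>s\<close> lies below
    \<open>f\<close>.\<close>
  also have "\<dots> = (\<integral>\<^sup>+x. ennreal r * (ennreal (1 / r) * s x) \<partial>M)"
    by (simp add: inv flip: mult.assoc)
  also have "\<dots> = ennreal r * (\<integral>\<^sup>+x. ennreal (1 / r) * s x \<partial>M)"
    using s by (intro nn_integral_cmult) (auto dest: borel_measurable_simple_function)
  also have "\<dots> \<le> ennreal r * (\<integral>\<^sup>+x. f x \<partial>M)"
  proof (intro mult_left_mono nn_integral_mono)
    fix x
    have "ennreal (1 / r) * s x \<le> ennreal (1 / r) * (ennreal r * f x)"
      using s(2) by (intro mult_left_mono) (auto simp: le_fun_def)
    then show "ennreal (1 / r) * s x \<le> f x"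
      using inv by (metis mult.assoc mult.commute mult_1)
  qed simp
  finally show "integral\<^sup>S M s \<le> ennreal r * integral\<^sup>N M f" .
qed

lemma arm_expectation_le_cmult:
  assumes "0 < r"
    and "AE D in arm_prior A. \<forall>u.
      (\<integral>\<^sup>+x. f u x \<partial>PiM UNIV (\<lambda>_. D)) \<le> ennreal r * (\<integral>\<^sup>+x. g u x \<partial>PiM UNIV (\<lambda>_. D))"
  shows "arm_expectation A f \<le> ennreal r * arm_expectation A g"
  unfolding arm_expectation_def
proof (rule order_trans[OF nn_integral_mono_AE nn_integral_cmult_le[OF assms(1)]])
  show "AE D in arm_prior A.
    (\<integral>\<^sup>+u. (\<integral>\<^sup>+x. f u x \<partial>PiM UNIV (\<lambda>_. D)) \<partial>uniform_measure lborel {0..1})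
    \<le> ennreal r *
      (\<integral>\<^sup>+u. (\<integral>\<^sup>+x. g u x \<partial>PiM UNIV (\<lambda>_. D)) \<partial>uniform_measure lborel {0..1})"
    using assms(2)
    by eventually_elim
      (rule order_trans[OF nn_integral_mono nn_integral_cmult_le[OF assms(1)]], blast)
qed

text \<open>Averages over initial segments of a decreasing sequence decrease: \<open>g H\<close>
  bounds the later terms from above and the first \<open>H\<close> terms from below. The averages
  are cross-multiplied to avoid division.\<close>

lemma sum_decseq_le:
  fixes g :: "nat \<Rightarrow> ennreal"
  assumes "\<And>k. g (Suc k) \<le> g k" "H \<le> T"
  shows "of_nat H * (\<Sum>k<T. g k) \<le> of_nat T * (\<Sum>k<H. g k)"
proof -
  have anti: "g j \<le> g i" if "i \<le> j" for i j
    using lift_Suc_antimono_le[of g] assms(1) that by blast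
  have "(\<Sum>k\<in>{H..<T}. g k) \<le> (\<Sum>k\<in>{H..<T}. g H)"
    by (rule sum_mono) (simp add: anti)
  then have tail: "(\<Sum>k\<in>{H..<T}. g k) \<le> of_nat (T - H) * g H"
    by simp
  have "(\<Sum>k<H. g H) \<le> (\<Sum>k<H. g k)"
    by (rule sum_mono) (simp add: anti)
  then have head: "of_nat H * g H \<le> (\<Sum>k<H. g k)"
    by simp
  have "(\<Sum>k<T. g k) = (\<Sum>k<H. g k) + (\<Sum>k\<in>{H..<T}. g k)"
    using sum.atLeastLessThan_concat[of 0 H T g] assms(2) by (simp add: lessThan_atLeast0)
  then have "of_nat H * (\<Sum>k<T. g k)
      \<le> of_nat H * (\<Sum>k<H. g k) + of_nat H * (of_nat (T - H) * g H)"
    using tail by (simp add: distrib_left mult_left_mono add_left_mono)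
  also have "\<dots> = of_nat H * (\<Sum>k<H. g k) + of_nat (T - H) * (of_nat H * g H)"
    by (simp add: mult.left_commute)
  also have "\<dots> \<le> of_nat H * (\<Sum>k<H. g k) + of_nat (T - H) * (\<Sum>k<H. g k)"
    by (intro add_left_mono mult_left_mono head) simp
  also have "\<dots> = of_nat (H + (T - H)) * (\<Sum>k<H. g k)"
    by (simp only: distrib_right of_nat_add)
  finally show ?thesis
    using assms(2) by simp
qed

section \<open>Exchangeability and decreasing marginal rewards\<close>

lemma AE_PiM_all:
  assumes "prob_space D" "AE r in D. Q r"
  shows "AE x in PiM (UNIV :: nat set) (\<lambda>_. D). \<forall>k. Q (x k)"
  unfolding AE_all_countable using assms by (intro allI AE_PiM_component) auto

text \<open>A product of identical factors is invariant under permuting its coordinates.\<close>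

lemma nn_integral_PiM_transpose:
  fixes D :: "real measure" and f :: "(nat \<Rightarrow> real) \<Rightarrow> ennreal"
  assumes "prob_space D" and f: "f \<in> borel_measurable (PiM UNIV (\<lambda>_. D))"
  shows "(\<integral>\<^sup>+x. f (\<lambda>i. x (Transposition.transpose j k i)) \<partial>PiM UNIV (\<lambda>_. D))
    = (\<integral>\<^sup>+x. f x \<partial>PiM UNIV (\<lambda>_. D))"
proof -
  let ?M = "PiM (UNIV :: nat set) (\<lambda>_. D)" and ?t = "\<lambda>x i. x (Transposition.transpose j k i)"
  have eq: "distr ?M ?M ?t = ?M"
    using distr_PiM_reindex[of UNIV "\<lambda>_. D" "Transposition.transpose j k" UNIV] assms
    by (simp add: restrict_UNIV)
  have "?t \<in> measurable ?M ?M"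
    by (rule measurable_PiM_single') (auto simp: space_PiM PiE_UNIV_domain)
  then show ?thesis
    using nn_integral_distr[of ?t ?M ?M f] f by (simp add: eq)
qed

text \<open>The increment of the capped reward in play \<open>k + 1\<close>, on the event that this play is made,
  is dominated by the increment that the outcome \<open>x (k + 1)\<close> would have caused in play \<open>k\<close>; by
  exchangeability the latter has the same expectation as the increment in play \<open>k\<close>.\<close>

lemma truncated_reward_ge:
  fixes D :: "real measure" and N :: "(nat \<Rightarrow> real) \<Rightarrow> nat"
  assumes D: "prob_space D" and sets_D: "sets D = sets borel"
    and nonneg: "AE r in D. 0 \<le> r" and B: "0 \<le> B"
    and N: "N \<in> measurable (PiM UNIV (\<lambda>_. borel)) (count_space UNIV)"
    and adapted: "\<And>x y k. (\<And>i. i < k \<Longrightarrow> x i = y i) \<Longrightarrow> k < N x \<longleftrightarrow> k < N y"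
    and N_le: "\<And>x. N x \<le> T" and H: "H \<le> T"
  shows "of_nat H * (\<integral>\<^sup>+x. ennreal (min B (\<Sum>k<N x. x k)) \<partial>PiM UNIV (\<lambda>_. D))
    \<le> of_nat T * (\<integral>\<^sup>+x. ennreal (min B (\<Sum>k<min (N x) H. x k)) \<partial>PiM UNIV (\<lambda>_. D))"
proof -
  let ?M = "PiM (UNIV :: nat set) (\<lambda>_. D)"
  define S where "S k x = (\<Sum>i<k. x i)" for k and x :: "nat \<Rightarrow> real"
  define \<phi> where "\<phi> k x = (if k < N x then min B (S (Suc k) x) - min B (S k x) else 0)" for k x
  define \<psi> where "\<psi> k x = (if k < N x then min B (S k x + x (Suc k)) - min B (S k x) else 0)"
    for k x
  define g where "g k = (\<integral>\<^sup>+x. ennreal (\<phi> k x) \<partial>?M)" for k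
  have sets_M: "sets ?M = sets (PiM UNIV (\<lambda>_. borel))"
    by (intro sets_PiM_cong) (auto simp: sets_D)
  have [measurable]: "N \<in> measurable ?M (count_space UNIV)"
    using N unfolding measurable_cong_sets[OF sets_M refl] .
  have comp [measurable]: "(\<lambda>x. x i) \<in> borel_measurable ?M" for i
    using measurable_component_singleton[of i UNIV "\<lambda>_. D"]
    by (simp add: measurable_cong_sets[OF refl sets_D])
  have [measurable]: "S k \<in> borel_measurable ?M" for k
    unfolding S_def by measurable
  have \<phi>_meas [measurable]: "\<phi> k \<in> borel_measurable ?M" for k
    unfolding \<phi>_def by measurable
  have AE_nonneg: "AE x in ?M. \<forall>k. 0 \<le> x k"
    using D nonneg by (rule AE_PiM_all)
  have telescope: "min B (\<Sum>k<min (N x) m. x k) = (\<Sum>k<m. \<phi> k x)" for m x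
  proof (induction m)
    case (Suc m)
    then show ?case
      by (cases "m < N x") (simp_all add: \<phi>_def S_def min_absorb1 min_absorb2)
  qed (use B in simp)
  have integral_eq:
    "(\<integral>\<^sup>+x. ennreal (min B (\<Sum>k<min (N x) m. x k)) \<partial>?M) = (\<Sum>k<m. g k)" for m
  proof -
    have "(\<integral>\<^sup>+x. ennreal (min B (\<Sum>k<min (N x) m. x k)) \<partial>?M)
        = (\<integral>\<^sup>+x. (\<Sum>k<m. ennreal (\<phi> k x)) \<partial>?M)"
      using AE_nonneg
      by (intro nn_integral_cong_AE, eventually_elim)
        (subst telescope, rule sum_ennreal[symmetric],
          auto simp: \<phi>_def S_def intro: min.coboundedI2)
    also have "\<dots> = (\<Sum>k<m. g k)"
      unfolding g_def by (rule nn_integral_sum) simp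
    finally show ?thesis .
  qed
  have "g (Suc k) \<le> g k" for k
  proof -
    have "g (Suc k) \<le> (\<integral>\<^sup>+x. ennreal (\<psi> k x) \<partial>?M)"
      unfolding g_def using AE_nonneg
    proof (intro nn_integral_mono_AE, eventually_elim)
      fix x :: "nat \<Rightarrow> real" assume "\<forall>k. 0 \<le> x k"
      then have "0 \<le> x k" "0 \<le> x (Suc k)"
        by auto
      \<comment> \<open>\<open>Suc k < N x\<close> implies \<open>k < N x\<close>, and by concavity
        of the cap, adding \<open>x (Suc k)\<close> to the larger sum \<open>S (Suc k) x\<close>
        raises the capped value by no more.\<close>
      then show "ennreal (\<phi> (Suc k) x) \<le> ennreal (\<psi> k x)"
        by (intro ennreal_leI) (auto simp: \<phi>_def \<psi>_def S_def min_def)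
    qed
    also have "\<psi> k x = \<phi> k (\<lambda>i. x (Transposition.transpose k (Suc k) i))" for x
    proof -
      let ?y = "\<lambda>i. x (Transposition.transpose k (Suc k) i)"
      \<comment> \<open>The swap leaves the first \<open>k\<close> outcomes alone, and these
        determine both \<open>S k\<close> and whether \<open>k < N\<close>.\<close>
      have eq: "?y i = x i" if "i < k" for i
        using that by (simp add: Transposition.transpose_def)
      then have "S k ?y = S k x"
        by (simp add: S_def)
      then show ?thesis
        using adapted[of k ?y x] eq by (simp add: \<phi>_def \<psi>_def S_def)
    qed
    then have "(\<integral>\<^sup>+x. ennreal (\<psi> k x) \<partial>?M) = g k"
      using nn_integral_PiM_transpose[OF D, of "\<lambda>x. ennreal (\<phi> k x)"] by (simp add: g_def)
    finally show ?thesis .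
  qed
  then have "of_nat H * (\<Sum>k<T. g k) \<le> of_nat T * (\<Sum>k<H. g k)"
    using H by (rule sum_decseq_le)
  then show ?thesis
    using N_le by (simp flip: integral_eq add: min_absorb1)
qed

section \<open>The doubling schedule\<close>

text \<open>Each doubling block makes one play more than all earlier blocks together, so the total
  before block \<open>b\<close> is \<open>2 ^ b - 1\<close>.\<close>

definition doubling_schedule :: "real \<Rightarrow> nat \<Rightarrow> nat \<Rightarrow> action" where
  "doubling_schedule c d t =
     (if 2 ^ (t div (2 * d + 1)) < c * real d \<and> 2 ^ (t div (2 * d + 1)) \<le> t mod (2 * d + 1)
      then Wait else Play)"

lemma doubling_schedule_neq_Quit [simp]: "doubling_schedule c d t \<noteq> Quit"
  by (simp add: doubling_schedule_def)

lemma doubling_schedule_in_block: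
  assumes "j < 2 * d + 1"
  shows "doubling_schedule c d (b * (2 * d + 1) + j) =
    (if 2 ^ b < c * real d \<and> 2 ^ b \<le> j then Wait else Play)"
proof -
  have "(b * (2 * d + 1) + j) div (2 * d + 1) = b"
    by (rule div_nat_eqI) (use assms in auto)
  moreover have "(b * (2 * d + 1) + j) mod (2 * d + 1) = j"
    using assms by (metis mod_less mod_mult_self3)
  ultimately show ?thesis
    by (simp add: doubling_schedule_def)
qed

lemma doubling_schedule_eventually_Play:
  assumes "c * real d \<le> 2 ^ b" "b * (2 * d + 1) \<le> t"
  shows "doubling_schedule c d t = Play"
proof -
  have "b \<le> t div (2 * d + 1)"
    using assms(2) by (simp add: less_eq_div_iff_mult_less_eq)
  then have "\<not> 2 ^ (t div (2 * d + 1)) < c * real d"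
    using assms(1) power_increasing[of b "t div (2 * d + 1)" "2::real"] by linarith
  then show ?thesis
    by (simp add: doubling_schedule_def)
qed

lemma plays_before_doubling_schedule_ge:
  assumes "c * real d \<le> 2 ^ b"
  shows "n - b * (2 * d + 1) \<le> plays_before (doubling_schedule c d) n"
proof -
  have "card {b * (2 * d + 1)..<n} \<le> plays_before (doubling_schedule c d) n"
    unfolding plays_before_def
    by (rule card_mono) (auto intro: doubling_schedule_eventually_Play[OF assms])
  then show ?thesis
    by simp
qed

context
  fixes c :: real and d :: nat
  assumes c: "c \<le> 1"
begin

text \<open>Consequently the plays of a doubling block occupy only its first \<open>d\<close> steps
  and are revealed before the next block starts.\<close>

lemma power2_less_delay: "2 ^ b < c * real d \<Longrightarrow> 2 ^ b \<le> d"
proof -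
  assume "2 ^ b < c * real d"
  also have "c * real d \<le> 1 * real d"
    by (intro mult_right_mono c) simp
  finally have "real (2 ^ b) < real d"
    by simp
  then show ?thesis
    by (simp only: of_nat_less_iff)
qed

lemma plays_before_doubling_schedule_in_block:
  assumes "2 ^ b < c * real d" "j \<le> 2 * d + 1"
  shows "plays_before (doubling_schedule c d) (b * (2 * d + 1) + j) =
    plays_before (doubling_schedule c d) (b * (2 * d + 1)) + min j (2 ^ b)"
  using assms(2)
proof (induction j)
  case (Suc j)
  then have "plays_before (doubling_schedule c d) (b * (2 * d + 1) + j) =
    plays_before (doubling_schedule c d) (b * (2 * d + 1)) + min j (2 ^ b)"
    by simp
  then show ?case
    using doubling_schedule_in_block[of j d c b] Suc.prems assms(1)
    by (simp only: add_Suc_right plays_before_Suc) auto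
qed simp

lemma plays_before_doubling_schedule_block_start:
  assumes "\<And>b'. b' < b \<Longrightarrow> 2 ^ b' < c * real d"
  shows "Suc (plays_before (doubling_schedule c d) (b * (2 * d + 1))) = 2 ^ b"
  using assms
proof (induction b)
  case (Suc b)
  then have "2 ^ b \<le> d"
    by (intro power2_less_delay) simp
  moreover have "Suc b * (2 * d + 1) = b * (2 * d + 1) + (2 * d + 1)"
    by simp
  ultimately show ?case
    using plays_before_doubling_schedule_in_block[of b "2 * d + 1"] Suc
    by (simp only:) simp
qed simp

lemma plays_before_doubling_schedule_known:
  assumes "\<And>b'. b' < b \<Longrightarrow> 2 ^ b' < c * real d" and t: "b * (2 * d + 1) \<le> t"
  shows "2 ^ b \<le> Suc (plays_before (doubling_schedule c d) (t - d))"
proof (cases b)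
  case (Suc b')
  then have small: "2 ^ b' < c * real d"
    using assms by simp
  \<comment> \<open>Going back \<open>d\<close> steps from the start of block \<open>b\<close> leads
    to offset \<open>d + 1\<close> in the previous block, behind all of its plays.\<close>
  have "2 ^ b = Suc (plays_before (doubling_schedule c d) (b' * (2 * d + 1) + (d + 1)))"
    using plays_before_doubling_schedule_in_block[OF small, of "d + 1"]
      plays_before_doubling_schedule_block_start[of b'] power2_less_delay[OF small] assms Suc
    by simp
  also have "\<dots> \<le> Suc (plays_before (doubling_schedule c d) (t - d))"
    using t Suc by (intro Suc_le_mono[THEN iffD2] plays_before_mono) simp
  finally show ?thesis .
qed simp

text \<open>The left-hand side counts the plays made when the policy decides to stop, the right-hand side
  the plays the simulated policy is known to make one step earlier.\<close>

lemma plays_before_doubling_schedule_Suc_le: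
  assumes "0 < c"
  shows "real (plays_before (doubling_schedule c d) (Suc t))
    \<le> (1 + 1 / c) * real (Suc (plays_before (doubling_schedule c d) (t - d)))"
    (is "real (?F (Suc t)) \<le> _")
proof -
  define b where "b = t div (2 * d + 1)"
  have t: "b * (2 * d + 1) \<le> t" "Suc t \<le> Suc b * (2 * d + 1)"
    using div_times_less_eq_dividend[of t "2 * d + 1"] dividend_less_div_times[of "2 * d + 1" t]
    by (auto simp: b_def)
  show ?thesis
  proof (cases "2 ^ b < c * real d")
    case True
    then have small: "2 ^ b' < c * real d" if "b' \<le> b" for b'
      using that power_increasing[of b' b "2::real"] by linarith
    \<comment> \<open>At the end of block \<open>b\<close> the total plus one is
      \<open>2 * 2 ^ b\<close>, while the \<open>2 ^ b - 1\<close> plays before the block are all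
      known; the factor \<open>2\<close> is at most \<open>1 + 1 / c\<close>.\<close>
    have "Suc (?F (Suc t)) \<le> Suc (?F (Suc b * (2 * d + 1)))"
      using t by (intro Suc_le_mono[THEN iffD2] plays_before_mono)
    also have "\<dots> = 2 * 2 ^ b"
      using plays_before_doubling_schedule_block_start[of "Suc b"] small by simp
    also have "\<dots> \<le> 2 * Suc (?F (t - d))"
      using plays_before_doubling_schedule_known[of b t] small t by simp
    finally have "real (?F (Suc t)) \<le> 2 * real (Suc (?F (t - d)))"
      by linarith
    also have "\<dots> \<le> (1 + 1 / c) * real (Suc (?F (t - d)))"
      using assms c by (intro mult_right_mono) auto
    finally show ?thesis .
  next
    case False
    \<comment> \<open>Block \<open>b0\<close> starts the continuous phase. All plays before it are
      known, so the known count plus one is at least \<open>2 ^ b0\<close>, hence at least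
      \<open>c * d\<close>. This pays for the at most \<open>d + 1\<close> further plays, one of
      which the \<open>Suc\<close> on the right absorbs.\<close>
    define b0 where "b0 = (LEAST b. c * real d \<le> 2 ^ b)"
    have b0: "c * real d \<le> 2 ^ b0" "b0 \<le> b"
      unfolding b0_def using False
      by (auto simp: not_less intro: LeastI[of "\<lambda>b. c * real d \<le> 2 ^ b"] Least_le)
    have "2 ^ b' < c * real d" if "b' < b0" for b'
      using not_less_Least[of b' "\<lambda>b. c * real d \<le> 2 ^ b"] that by (simp add: b0_def)
    moreover have "b0 * (2 * d + 1) \<le> t"
      using b0 t by (meson le_trans mult_le_mono1)
    ultimately have "2 ^ b0 \<le> Suc (?F (t - d))"
      by (rule plays_before_doubling_schedule_known)
    then have "(2::real) ^ b0 \<le> real (Suc (?F (t - d)))"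
      by (metis of_nat_le_iff of_nat_numeral of_nat_power)
    then have "c * real d \<le> real (Suc (?F (t - d)))"
      using b0 by linarith
    then have "real d \<le> 1 / c * real (Suc (?F (t - d)))"
      using assms by (simp add: field_simps)
    moreover have "?F (Suc t) \<le> ?F (t - d) + Suc d"
      by (rule order_trans[OF plays_before_mono plays_before_add_le]) simp
    ultimately show ?thesis
      by (simp add: distrib_right)
  qed
qed

text \<open>Quitting at \<open>q\<close> cuts the plays of a block to a shorter initial segment. A
  block with at least \<open>c * d\<close> plays cannot belong to the doubling phase, and a block of
  the continuous phase cut below \<open>c * d\<close> plays has at most \<open>d + 1\<close> of
  them.\<close>

lemma well_structured_stopped_schedule:
  assumes a: "\<And>t. a t = (if t < q then doubling_schedule c d t else Quit)"
    and b: "c * real d \<le> 2 ^ b" "real b \<le> \<beta> * (real T / real d)"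
  shows "well_structured T \<beta> c d a"
proof -
  have cont: "plays_continuously_from d a b" if "c * real d \<le> 2 ^ b" for b
    unfolding plays_continuously_from_def a
    using doubling_schedule_eventually_Play[OF that] by auto
  have shape: "\<exists>m. (2 ^ b < c * real d \<longrightarrow> m \<le> 2 ^ b) \<and> m \<le> 2 * d + 1 \<and>
      (\<forall>t\<in>block d b. a t = Play \<longleftrightarrow> t < b * (2 * d + 1) + m)" for b
  proof -
    define m where "m = min (q - b * (2 * d + 1))
      (if 2 ^ b < c * real d then 2 ^ b else 2 * d + 1)"
    have "a t = Play \<longleftrightarrow> t < b * (2 * d + 1) + m" if "t \<in> block d b" for t
    proof -
      define j where "j = t - b * (2 * d + 1)"
      have j: "t = b * (2 * d + 1) + j" "j < 2 * d + 1"
        using that by (auto simp: block_def j_def)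
      show ?thesis
        unfolding a j(1) doubling_schedule_in_block[OF j(2)] m_def using j(2) by auto
    qed
    moreover have "m \<le> 2 * d + 1"
      using power2_less_delay[of b] by (auto simp: m_def)
    ultimately show ?thesis
      by (intro exI[of _ m]) (auto simp: m_def)
  qed
  have "if real (block_plays d a b) < c * real d then block_shaped d a b
      else plays_continuously_from d a b" for b
  proof -
    obtain m where m: "2 ^ b < c * real d \<longrightarrow> m \<le> 2 ^ b" "m \<le> 2 * d + 1"
      "\<forall>t\<in>block d b. a t = Play \<longleftrightarrow> t < b * (2 * d + 1) + m"
      using shape by blast
    have "{t \<in> block d b. a t = Play} = {b * (2 * d + 1)..<b * (2 * d + 1) + m}"
      using m(2,3) by (auto simp: block_def)
    then have bp: "block_plays d a b = m"
      by (simp add: block_plays_def)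
    show ?thesis
    proof (cases "real m < c * real d")
      case True
      also have "c * real d \<le> 1 * real d"
        by (intro mult_right_mono c) simp
      finally have "m \<le> d + 1"
        by simp
      then show ?thesis
        using True m(3) by (auto simp: bp block_shaped_def)
    next
      case False
      have "real m \<le> 2 ^ b" if "2 ^ b < c * real d"
        using m(1) that by (metis of_nat_le_iff of_nat_numeral of_nat_power)
      then have "c * real d \<le> 2 ^ b"
        using False by linarith
      then show ?thesis
        using False by (simp add: bp cont)
    qed
  qed
  then show ?thesis
    using b cont unfolding well_structured_def delay_free_block_structured_def by blast
qed

end

section \<open>The doubling policy\<close>

text \<open>Whether \<open>P\<close> makes more than \<open>length ys\<close> plays depends only on the outcomes \<open>ys\<close> of its first
  \<open>length ys\<close> plays, so the padding with \<open>0\<close> is immaterial.\<close>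

definition plays_beyond :: "arm \<Rightarrow> policy \<Rightarrow> real \<Rightarrow> real list \<Rightarrow> bool" where
  "plays_beyond A P u ys \<longleftrightarrow>
     length ys < num_plays A P u (\<lambda>i. if i < length ys then ys ! i else 0)"

text \<open>\<open>P\<close> is only consulted, not executed: its stopping rule is evaluated on the
  revealed outcomes, while the schedule sets the times of the plays.\<close>

definition doubling_policy :: "arm \<Rightarrow> nat \<Rightarrow> real \<Rightarrow> policy \<Rightarrow> policy" where
  "doubling_policy A H c P u t ys =
     (if t < H \<and> plays_beyond A P u ys then doubling_schedule c (arm_delay A) t else Quit)"

lemma plays_beyond_map:
  assumes "P \<in> single_arm_policies A T"
  shows "plays_beyond A P u (map x [0..<k]) \<longleftrightarrow> k < num_plays A P u x"
  unfolding plays_beyond_def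
  using num_plays_nonanticipating[OF assms, of k "\<lambda>i. if i < k then map x [0..<k] ! i else 0" x]
  by simp

lemma measurable_doubling_policy:
  assumes "P \<in> single_arm_policies A T"
  shows "measurable_policy (doubling_policy A H c P)"
  unfolding measurable_policy_def
proof (intro allI)
  fix t k
  let ?M = "borel \<Otimes>\<^sub>M PiM (UNIV :: nat set) (\<lambda>_. borel :: real measure)"
  have "(\<lambda>w. if t < H \<and> k < num_plays A P (fst w) (snd w)
      then doubling_schedule c (arm_delay A) t else Quit) \<in> measurable ?M (count_space UNIV)"
    by (rule measurable_compose[OF measurable_num_plays[OF assms]]) simp
  then show "(\<lambda>(u, x). doubling_policy A H c P u t (map x [0..<k]))
      \<in> measurable ?M (count_space UNIV)"
    unfolding doubling_policy_def plays_beyond_map[OF assms] case_prod_unfold .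
qed

text \<open>Up to the first quitting time \<open>q\<close> the actions are those of the schedule, so
  the number of revealed outcomes is a function of time alone. The stopping test passes before
  \<open>q\<close>; at \<open>q\<close> it fails, unless the horizon is reached.\<close>

lemma action_at_doubling_policy:
  fixes A H c P u x
  assumes P: "P \<in> single_arm_policies A T"
  defines "d \<equiv> arm_delay A"
  defines "a \<equiv> action_at d (doubling_policy A H c P u) x"
  obtains q where "q \<le> H"
    and "\<And>t. a t = (if t < q then doubling_schedule c d t else Quit)"
    and "\<And>t. t < q \<Longrightarrow> plays_before (doubling_schedule c d) (t - d) < num_plays A P u x"
    and "q = H \<or> num_plays A P u x \<le> plays_before (doubling_schedule c d) (q - d)"
proof -
  have rec: "a t = (if (\<exists>s<t. a s = Quit) then Quit
      else if t < H \<and> plays_before a (t - d) < num_plays A P u x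
      then doubling_schedule c d t else Quit)" for t
    using action_at_rec[of d "doubling_policy A H c P u" x t]
    unfolding a_def[symmetric] doubling_policy_def plays_beyond_map[OF P] d_def[symmetric] .
  define q where "q = (LEAST t. a t = Quit)"
  have "a H = Quit"
    using rec[of H] by auto
  then have q: "a q = Quit" "q \<le> H"
    unfolding q_def by (auto intro: LeastI Least_le)
  have before: "a t \<noteq> Quit" if "t < q" for t
    using that not_less_Least[of t "\<lambda>t. a t = Quit"] by (simp add: q_def)
  have sched: "a t = doubling_schedule c d t" "plays_before a (t - d) < num_plays A P u x"
    if "t < q" for t
    using before[OF that] rec[of t] by (auto split: if_splits)
  have pb: "plays_before a (t - d) = plays_before (doubling_schedule c d) (t - d)"
    if "t \<le> q" for t
    using that by (intro plays_before_cong sched(1)) simp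
  show ?thesis
  proof (rule that[of q])
    show "a t = (if t < q then doubling_schedule c d t else Quit)" for t
      using sched(1)[of t] q(1) action_at_Quit_mono[of d _ x q t] by (auto simp: a_def)
    show "plays_before (doubling_schedule c d) (t - d) < num_plays A P u x" if "t < q" for t
      using sched(2)[OF that] pb[of t] that by simp
    have "\<not> (q < H \<and> plays_before a (q - d) < num_plays A P u x)"
      using rec[of q] q(1) before by (metis doubling_schedule_neq_Quit)
    then show "q = H \<or> num_plays A P u x \<le> plays_before (doubling_schedule c d) (q - d)"
      using q(2) pb[of q] by auto
  qed (rule q(2))
qed

lemma doubling_policy_in_single_arm_policies:
  assumes "P \<in> single_arm_policies A T"
  shows "doubling_policy A H c P \<in> single_arm_policies A H"
proof -
  have "action_at (arm_delay A) (doubling_policy A H c P u) x H = Quit" for u x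
    by (subst action_at_rec) (simp add: doubling_policy_def)
  then show ?thesis
    using measurable_doubling_policy[OF assms] by (simp add: single_arm_policies_def)
qed

text \<open>Upper bound: one step before \<open>q\<close> the test still passed, so \<open>P\<close>
  makes more plays than were known then. Lower bound: the policy ends either at \<open>H\<close>,
  with all scheduled plays made, or once the known plays are at least as many as those of
  \<open>P\<close>.\<close>

lemma num_plays_doubling_policy:
  assumes P: "P \<in> single_arm_policies A T" and c: "0 < c" "c \<le> 1"
  shows "real (num_plays A (doubling_policy A H c P) u x) \<le> (1 + 1 / c) * real (num_plays A P u x)"
    and "min (num_plays A P u x) (plays_before (doubling_schedule c (arm_delay A)) H)
      \<le> num_plays A (doubling_policy A H c P) u x"
proof -
  let ?d = "arm_delay A"
  let ?F = "plays_before (doubling_schedule c ?d)"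
  let ?a = "action_at ?d (doubling_policy A H c P u) x"
  obtain q where q: "q \<le> H" "\<And>t. ?a t = (if t < q then doubling_schedule c ?d t else Quit)"
    "\<And>t. t < q \<Longrightarrow> ?F (t - ?d) < num_plays A P u x"
    "q = H \<or> num_plays A P u x \<le> ?F (q - ?d)"
    by (rule action_at_doubling_policy[OF P, of H c u x]) blast
  have "{t. ?a t = Play} = {t. t < q \<and> doubling_schedule c ?d t = Play}"
    by (auto simp: q(2))
  then have M: "num_plays A (doubling_policy A H c P) u x = ?F q"
    by (simp add: num_plays_def plays_before_def)
  show "real (num_plays A (doubling_policy A H c P) u x) \<le> (1 + 1 / c) * real (num_plays A P u x)"
  proof (cases q)
    case (Suc t)
    have "real (?F q) \<le> (1 + 1 / c) * real (Suc (?F (t - ?d)))"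
      unfolding Suc using c by (rule_tac plays_before_doubling_schedule_Suc_le)
    also have "\<dots> \<le> (1 + 1 / c) * real (num_plays A P u x)"
      using q(3)[of t] Suc c by (intro mult_left_mono) auto
    finally show ?thesis
      by (simp add: M)
  qed (use c in \<open>simp add: M\<close>)
  show "min (num_plays A P u x) (?F H) \<le> num_plays A (doubling_policy A H c P) u x"
    unfolding M using q(4) plays_before_mono[of "q - ?d" q "doubling_schedule c ?d"] by auto
qed

lemma doubling_policy_truncated_well_structured:
  assumes "P \<in> single_arm_policies A T'" "c \<le> 1"
    and "c * real (arm_delay A) \<le> 2 ^ b" "real b \<le> \<beta> * (real T / real (arm_delay A))"
  shows "doubling_policy A (T div 2) c P \<in> truncated_well_structured_policies A T \<beta> c"
proof -
  have "well_structured T \<beta> c (arm_delay A)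
      (action_at (arm_delay A) (doubling_policy A (T div 2) c P u) x)" for u x
    by (rule action_at_doubling_policy[OF assms(1), of "T div 2" c u x])
      (rule well_structured_stopped_schedule[OF assms(2) _ assms(3,4)])
  then show ?thesis
    using doubling_policy_in_single_arm_policies[OF assms(1)]
    by (simp add: truncated_well_structured_policies_def)
qed

section \<open>Expected plays and rewards of the doubling policy\<close>

lemma expected_plays_doubling_policy:
  assumes P: "P \<in> single_arm_policies A T" and c: "0 < c" "c \<le> 1"
  shows "expected_plays A (doubling_policy A H c P) \<le> ennreal (1 + 1 / c) * expected_plays A P"
  unfolding expected_plays_def
proof (rule arm_expectation_le_cmult)
  show r: "0 < 1 + 1 / c"
    using c by (simp add: add_pos_pos)
  have "of_nat (num_plays A (doubling_policy A H c P) u x)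
      \<le> ennreal (1 + 1 / c) * of_nat (num_plays A P u x)" for u x
    using num_plays_doubling_policy(1)[OF P c, of H u x] r
    by (simp add: ennreal_of_nat_eq_real_of_nat ennreal_leI flip: ennreal_mult)
  then show "AE D in arm_prior A. \<forall>u.
      (\<integral>\<^sup>+x. of_nat (num_plays A (doubling_policy A H c P) u x) \<partial>PiM UNIV (\<lambda>_. D))
      \<le> ennreal (1 + 1 / c) * (\<integral>\<^sup>+x. of_nat (num_plays A P u x) \<partial>PiM UNIV (\<lambda>_. D))"
    by (intro AE_I2 allI order_trans[OF nn_integral_mono nn_integral_cmult_le[OF r]])
qed

text \<open>The number of plays scheduled before \<open>H\<close> is deterministic and at least
  \<open>\<alpha> * T\<close>. The new policy earns at least the reward of that many first plays of
  \<open>P\<close>, which by decreasing marginal rewards is at least the fraction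
  \<open>\<alpha>\<close> of the whole.\<close>

lemma expected_reward_doubling_policy:
  assumes A: "valid_arm A" and P: "P \<in> single_arm_policies A T"
    and c: "0 < c" "c \<le> 1" and \<alpha>: "0 < \<alpha>"
    and H: "\<alpha> * real T \<le> real (plays_before (doubling_schedule c (arm_delay A)) H)" "H \<le> T"
    and T: "0 < T"
  shows "expected_reward A P \<le> ennreal (1 / \<alpha>) * expected_reward A (doubling_policy A H c P)"
  unfolding expected_reward_def
proof (rule arm_expectation_le_cmult)
  let ?K = "plays_before (doubling_schedule c (arm_delay A)) H"
  have prior: "arm_prior A \<in> space (prob_algebra (prob_algebra borel))"
    and nonneg: "AE D in arm_prior A. AE r in D. 0 \<le> r" and B: "0 \<le> arm_budget A"
    using A by (auto simp: valid_arm_def)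
  have "space (arm_prior A) = space (prob_algebra borel)"
    using prior by (intro sets_eq_imp_space_eq) (simp add: space_prob_algebra)
  then have "AE D in arm_prior A. D \<in> space (prob_algebra borel)"
    using AE_space[of "arm_prior A"] by simp
  then show "AE D in arm_prior A. \<forall>u.
      (\<integral>\<^sup>+x. ennreal (min (arm_budget A) (\<Sum>k<num_plays A P u x. x k)) \<partial>PiM UNIV (\<lambda>_. D))
      \<le> ennreal (1 / \<alpha>) *
        (\<integral>\<^sup>+x. ennreal (min (arm_budget A)
          (\<Sum>k<num_plays A (doubling_policy A H c P) u x. x k)) \<partial>PiM UNIV (\<lambda>_. D))"
    using nonneg
  proof eventually_elim
    case (elim D)
    show ?case
    proof
      fix u
      let ?M = "PiM (UNIV :: nat set) (\<lambda>_. D)"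
      let ?f = "\<lambda>n x. ennreal (min (arm_budget A) (\<Sum>k<n. x k))"
      let ?I = "\<integral>\<^sup>+x. ?f (num_plays A P u x) x \<partial>?M"
      let ?J = "\<integral>\<^sup>+x. ?f (num_plays A (doubling_policy A H c P) u x) x \<partial>?M"
      have D: "prob_space D" "sets D = sets borel"
        using elim(1) by (auto simp: space_prob_algebra)
      have "(\<lambda>x. (u, x)) \<in> measurable (PiM (UNIV :: nat set) (\<lambda>_. borel :: real measure))
          (borel \<Otimes>\<^sub>M PiM UNIV (\<lambda>_. borel))"
        by simp
      from measurable_compose[OF this measurable_num_plays[OF P]]
      have N: "num_plays A P u \<in> measurable (PiM UNIV (\<lambda>_. borel)) (count_space UNIV)"
        by simp
      have K_le: "?K \<le> T"
        using plays_before_add_le[of "doubling_schedule c (arm_delay A)" 0 H] H(2) by simp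
      have "of_nat ?K * ?I
          \<le> of_nat T * (\<integral>\<^sup>+x. ?f (min (num_plays A P u x) ?K) x \<partial>?M)"
        using truncated_reward_ge[OF D elim(2) B N _ _ K_le]
          num_plays_nonanticipating[OF P] num_plays_le_horizon[OF P] by blast
      also have "\<dots> \<le> of_nat T * ?J"
      proof (intro mult_left_mono nn_integral_mono_AE)
        have "AE x in ?M. \<forall>k. 0 \<le> x k"
          using D(1) elim(2) by (rule AE_PiM_all)
        then show "AE x in ?M. ?f (min (num_plays A P u x) ?K) x
            \<le> ?f (num_plays A (doubling_policy A H c P) u x) x"
        proof eventually_elim
          case (elim x)
          then show ?case
            using num_plays_doubling_policy(2)[OF P c, of u x H]
            by (intro ennreal_leI min.mono order_refl sum_mono2) auto
        qed
      qed simp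
      finally have KI: "of_nat ?K * ?I \<le> of_nat T * ?J" .
      have "ennreal (\<alpha> * real T) * ?I \<le> of_nat ?K * ?I"
        using H(1) by (intro mult_right_mono) (simp_all add: ennreal_of_nat_eq_real_of_nat ennreal_leI)
      with KI have "ennreal (\<alpha> * real T) * ?I \<le> of_nat T * ?J"
        by (rule order_trans[rotated])
      then have "ennreal (1 / (\<alpha> * real T)) * (ennreal (\<alpha> * real T) * ?I)
          \<le> ennreal (1 / (\<alpha> * real T)) * (of_nat T * ?J)"
        by (rule mult_left_mono) simp
      moreover have "ennreal (1 / (\<alpha> * real T)) * ennreal (\<alpha> * real T) = 1"
        "ennreal (1 / (\<alpha> * real T)) * of_nat T = ennreal (1 / \<alpha>)"
        using \<alpha> T by (simp_all add: ennreal_of_nat_eq_real_of_nat flip: ennreal_mult)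
      ultimately show "?I \<le> ennreal (1 / \<alpha>) * ?J"
        by (simp flip: mult.assoc)
    qed
  qed
qed (use \<alpha> in simp)

section \<open>Number of doubling blocks and comparison of the optima\<close>

lemma exists_block_bound:
  assumes d: "0 < d" "real d \<le> \<eta> * real T / ln (real T)" and \<eta>: "\<eta> \<le> 1" and T: "3 \<le> T"
  shows "\<exists>b. real d \<le> 2 ^ b \<and> real b * real d \<le> 3 * \<eta> * real T"
proof -
  have ln_T: "1 \<le> ln (real T)"
    using T exp_le by (subst ln_ge_iff) auto
  have "real d \<le> real T"
  proof -
    have "\<eta> * real T \<le> real T * ln (real T)"
      using mult_mono[of \<eta> 1 "real T" "real T"] mult_left_mono[of 1 "ln (real T)" "real T"] \<eta> ln_T
      by simp
    then show ?thesis
      using d(2) ln_T by (smt (verit, best) divide_le_eq)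
  qed
  \<comment> \<open>With \<open>2 ^ b\<close> at least \<open>d\<close>, the doubling phase is over
    by block \<open>b\<close> for every \<open>c \<le> 1\<close>.\<close>
  define b where "b = nat \<lceil>log 2 (real d)\<rceil>"
  have log_nonneg: "0 \<le> log 2 (real d)"
    using d(1) by simp
  have "real d = 2 powr log 2 (real d)"
    using d(1) by simp
  also have "\<dots> \<le> 2 powr real b"
    unfolding b_def by (intro powr_mono) linarith+
  finally have "real d \<le> 2 ^ b"
    by (simp add: powr_realpow)
  \<comment> \<open>Changing the base costs a factor of at most \<open>3 / 2\<close>, and rounding
    up costs \<open>1 \<le> ln T\<close>.\<close>
  moreover have "real b \<le> 3 * ln (real T)"
  proof -
    have "real b \<le> log 2 (real d) + 1"
      using log_nonneg unfolding b_def by linarith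
    also have "log 2 (real d) \<le> log 2 (real T)"
      using \<open>real d \<le> real T\<close> d(1) T by simp
    also have "log 2 (real T) = ln (real T) / ln 2"
      by (simp add: log_def)
    also have "\<dots> \<le> ln (real T) / (2 / 3)"
      using ln2_ge_two_thirds ln_T by (intro divide_left_mono) auto
    finally show ?thesis
      using ln_T by simp
  qed
  then have "real b * real d \<le> 3 * ln (real T) * (\<eta> * real T / ln (real T))"
    using d ln_T by (intro mult_mono) auto
  ultimately show ?thesis
    using ln_T by (intro exI[of _ b]) (simp add: mult.assoc)
qed

text \<open>Policies are replaced arm by arm; plays and rewards compare by fixed factors, so the
  bounds survive summation. In \<open>block\<close>, the doubling phase is over by block
  \<open>b\<close>, and the last conjunct leaves \<open>\<alpha> * T\<close> steps of continuous
  play before \<open>T div 2\<close>.\<close>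

lemma optimal_reward_le_doubling:
  assumes valid: "\<And>i. i < n \<Longrightarrow> valid_arm (A i)"
    and c: "0 < c" "c \<le> 1" and \<alpha>: "0 < \<alpha>" and T: "0 < T"
    and block: "\<And>i. i < n \<Longrightarrow> \<exists>b. c * real (arm_delay (A i)) \<le> 2 ^ b \<and>
      real b \<le> \<beta> * (real T / real (arm_delay (A i))) \<and>
      \<alpha> * real T \<le> real (T div 2 - b * (2 * arm_delay (A i) + 1))"
    and \<gamma>: "1 + 1 / c \<le> \<gamma>"
  shows "optimal_reward n A (\<lambda>B. single_arm_policies B T) (real T)
    \<le> ennreal (1 / \<alpha>) *
      optimal_reward n A (\<lambda>B. truncated_well_structured_policies B T \<beta> c) (\<gamma> * real T)"
    (is "_ \<le> _ * ?R")
  unfolding optimal_reward_def[of _ _ "\<lambda>B. single_arm_policies B T"]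
proof (rule SUP_least, safe)
  fix P :: "nat \<Rightarrow> policy"
  assume P: "\<forall>i<n. P i \<in> single_arm_policies (A i) T"
    and plays: "(\<Sum>i<n. expected_plays (A i) (P i)) \<le> ennreal (real T)"
  define P' where "P' i = doubling_policy (A i) (T div 2) c (P i)" for i
  have P'_in: "P' i \<in> truncated_well_structured_policies (A i) T \<beta> c"
    and reward: "expected_reward (A i) (P i) \<le> ennreal (1 / \<alpha>) * expected_reward (A i) (P' i)"
    if i: "i < n" for i
  proof -
    obtain b where b: "c * real (arm_delay (A i)) \<le> 2 ^ b"
      "real b \<le> \<beta> * (real T / real (arm_delay (A i)))"
      "\<alpha> * real T \<le> real (T div 2 - b * (2 * arm_delay (A i) + 1))"
      using block[OF i] by blast
    have Pi: "P i \<in> single_arm_policies (A i) T"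
      using P i by blast
    show "P' i \<in> truncated_well_structured_policies (A i) T \<beta> c"
      unfolding P'_def
      by (rule doubling_policy_truncated_well_structured[OF Pi c(2) b(1,2)])
    have "\<alpha> * real T
        \<le> real (plays_before (doubling_schedule c (arm_delay (A i))) (T div 2))"
      using b(3) plays_before_doubling_schedule_ge[OF b(1), of "T div 2"] by linarith
    then show "expected_reward (A i) (P i) \<le> ennreal (1 / \<alpha>) * expected_reward (A i) (P' i)"
      unfolding P'_def
      using expected_reward_doubling_policy[OF valid[OF i] Pi c \<alpha>] T by simp
  qed
  have "(\<Sum>i<n. expected_plays (A i) (P' i))
      \<le> (\<Sum>i<n. ennreal (1 + 1 / c) * expected_plays (A i) (P i))"
    unfolding P'_def using P c by (intro sum_mono expected_plays_doubling_policy) auto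
  also have "\<dots> = ennreal (1 + 1 / c) * (\<Sum>i<n. expected_plays (A i) (P i))"
    by (simp add: sum_distrib_left)
  also have "\<dots> \<le> ennreal \<gamma> * ennreal (real T)"
    using \<gamma> by (intro mult_mono plays ennreal_leI) auto
  also have "\<dots> = ennreal (\<gamma> * real T)"
    using \<gamma> c by (subst ennreal_mult) (auto intro: order_trans[OF _ \<gamma>])
  finally have feasible: "(\<Sum>i<n. expected_plays (A i) (P' i)) \<le> ennreal (\<gamma> * real T)" .
  have "(\<Sum>i<n. expected_reward (A i) (P i))
      \<le> (\<Sum>i<n. ennreal (1 / \<alpha>) * expected_reward (A i) (P' i))"
    by (intro sum_mono reward) simp
  also have "\<dots> = ennreal (1 / \<alpha>) * (\<Sum>i<n. expected_reward (A i) (P' i))"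
    by (simp add: sum_distrib_left)
  also have "\<dots> \<le> ennreal (1 / \<alpha>) * ?R"
    unfolding optimal_reward_def using P'_in feasible
    by (intro mult_left_mono SUP_upper) auto
  finally show "(\<Sum>i<n. expected_reward (A i) (P i)) \<le> ennreal (1 / \<alpha>) * ?R" .
qed

theorem theorem4:
  fixes n :: "nat \<Rightarrow> nat" and A :: "nat \<Rightarrow> nat \<Rightarrow> arm" and \<alpha> \<gamma> :: real
  assumes "\<And>T. 0 < n T"
    and "\<And>T i. i < n T \<Longrightarrow> valid_arm (A T i)"
    and "(\<lambda>T. real (MAX i\<in>{..<n T}. arm_delay (A T i))) \<in> o(\<lambda>T. real T / ln (real T))"
    and "0 < \<alpha>" and "\<alpha> \<le> 1 / 8"
    and "\<gamma> = 2 * (1 + 1 / \<alpha>) * (1 + 2 / \<alpha>)"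
  shows "\<exists>\<epsilon> :: nat \<Rightarrow> real. \<epsilon> \<longlonglongrightarrow> 0 \<and>
    (\<forall>\<^sub>F T in sequentially.
       optimal_reward (n T) (A T) (\<lambda>B. single_arm_policies B T) (real T)
       \<le> ennreal (1 / \<alpha>) *
         optimal_reward (n T) (A T)
           (\<lambda>B. truncated_well_structured_policies B T (\<alpha> + \<epsilon> T) (\<alpha> / (\<alpha> + 2))) (\<gamma> * real T))"
proof (intro exI conjI)
  show "(\<lambda>_. 0 :: real) \<longlonglongrightarrow> 0"
    by simp
  let ?c = "\<alpha> / (\<alpha> + 2)"
  have c: "0 < ?c" "?c \<le> 1"
    using assms(4) by auto
  \<comment> \<open>For this \<open>c\<close>, \<open>1 / c\<close> equals
    \<open>1 + 2 / \<alpha>\<close>.\<close>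
  have "1 + 1 / ?c = 2 * (1 + 1 / \<alpha>)"
    using assms(4) by (simp add: field_simps)
  also have "\<dots> \<le> 2 * (1 + 1 / \<alpha>) * (1 + 2 / \<alpha>)"
    using mult_left_mono[of 1 "1 + 2 / \<alpha>" "2 * (1 + 1 / \<alpha>)"] assms(4) by simp
  finally have \<gamma>: "1 + 1 / ?c \<le> \<gamma>"
    using assms(6) by simp
  \<comment> \<open>The constant \<open>\<alpha> / 9\<close> offsets a factor \<open>3\<close> from
    \<open>exists_block_bound\<close> and another from \<open>2 * d + 1 \<le> 3 * d\<close>, so the
    first \<open>b\<close> blocks take at most \<open>\<alpha> * T\<close> steps.\<close>
  have "\<forall>\<^sub>F T in sequentially. norm (real (MAX i\<in>{..<n T}. arm_delay (A T i)))
      \<le> \<alpha> / 9 * norm (real T / ln (real T))"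
    using landau_o.smallD[OF assms(3), of "\<alpha> / 9"] assms(4) by simp
  moreover have "\<forall>\<^sub>F T in sequentially. 3 \<le> T"
    by (rule eventually_ge_at_top)
  ultimately show "\<forall>\<^sub>F T in sequentially.
       optimal_reward (n T) (A T) (\<lambda>B. single_arm_policies B T) (real T)
       \<le> ennreal (1 / \<alpha>) *
         optimal_reward (n T) (A T)
           (\<lambda>B. truncated_well_structured_policies B T (\<alpha> + 0) ?c) (\<gamma> * real T)"
  proof eventually_elim
    case (elim T)
    show ?case
    proof (rule optimal_reward_le_doubling[OF assms(2) c assms(4) _ _ \<gamma>])
      fix i assume i: "i < n T"
      let ?d = "arm_delay (A T i)"
      have d: "0 < ?d"
        using assms(2)[OF i] by (simp add: valid_arm_def)
      have "?d \<le> (MAX i\<in>{..<n T}. arm_delay (A T i))"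
        using i by (intro Max_ge) auto
      then have "real ?d \<le> \<alpha> / 9 * real T / ln (real T)"
        using elim by (simp add: abs_of_nonneg)
      then obtain b where b: "real ?d \<le> 2 ^ b" "real b * real ?d \<le> 3 * (\<alpha> / 9) * real T"
        using exists_block_bound[OF d, of "\<alpha> / 9" T] assms(5) elim(2) by auto
      have \<alpha>T: "0 \<le> \<alpha> * real T" "\<alpha> * real T \<le> real T / 8"
        using assms(4,5) mult_right_mono[of \<alpha> "1 / 8" "real T"] by auto
      have "?c * real ?d \<le> 1 * real ?d"
        using c by (intro mult_right_mono) auto
      then have "?c * real ?d \<le> 2 ^ b"
        using b(1) by linarith
      moreover have "real b \<le> (\<alpha> + 0) * (real T / real ?d)"
        using b(2) d \<alpha>T(1) by (simp add: pos_le_divide_eq)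
      moreover have "\<alpha> * real T \<le> real (T div 2 - b * (2 * ?d + 1))"
      proof -
        have "b * (2 * ?d + 1) \<le> b * (3 * ?d)"
          using d by (intro mult_left_mono) auto
        then have "real (b * (2 * ?d + 1)) \<le> real (b * (3 * ?d))"
          by (simp only: of_nat_le_iff)
        also have "\<dots> \<le> \<alpha> * real T"
          using b(2) by simp
        \<comment> \<open>\<open>T div 2\<close> is at least \<open>(T - 1) / 2\<close>; removing at
          most \<open>T / 8\<close> steps leaves at least \<open>T / 8\<close>, since
          \<open>T \<ge> 3\<close>.\<close>
        finally show ?thesis
          using \<alpha>T(2) elim(2) by linarith
      qed
      ultimately show "\<exists>b. ?c * real ?d \<le> 2 ^ b \<and> real b \<le> (\<alpha> + 0) * (real T / real ?d) \<and>
          \<alpha> * real T \<le> real (T div 2 - b * (2 * ?d + 1))"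
        by blast
    qed (use elim(2) in auto)
  qed
qed

end
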